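(* The variety $\mathcal{CHA}$ of connexive Heyting algebras has a quaternary deductive term: there is a term $\varphi(x,y,z,w)$ in the language $\langle\wedge,\vee,\rightarrow,0,1\rangle$ such that for every $\mathbf A\in\mathcal{CHA}$ and all $a,b,c,d\in A$, $\varphi^{\mathbf A}(a,b,c,d)=c$ if $a=b$, and $\varphi^{\mathbf A}(a,b,c,d)=d$ if $\langle c,d\rangle\in\theta^{\mathbf A}(a,b)$.
   Context: $\theta^{\mathbf A}(a,b)$ denotes the principal congruence of $\mathbf A$ generated by the pair $\langle a,b\rangle$. A connexive Heyting algebra is an algebra $\langle A,\wedge,\vee,\rightarrow,0,1\rangle$ whose $\{\wedge,\vee,0,1\}$-reduct is a bounded distributive lattice (order $\le$) satisfying, with $\neg x:=x\rightarrow0$: (C1) $(x\rightarrow y)\rightarrow((y\rightarrow z)\rightarrow(x\rightarrow z))=1$; (C2) $(x\rightarrow y)\rightarrow\neg(x\rightarrow\neg y)=1$; (C3) $x\wedge(x\rightarrow y)=x\wedge y$; (C4) $x\rightarrow y\le(z\wedge x)\rightarrow(z\wedge y)$; (C5) $x\rightarrow y\le(z\vee x)\rightarrow(z\vee y)$. $\mathcal{CHA}$ is the variety of all such algebras. *)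

theory Defs
  imports Main
begin

record 'a cha_algebra =
  carrier :: "'a set"
  meet :: "'a \<Rightarrow> 'a \<Rightarrow> 'a" (infixl \<open>\<sqinter>\<index>\<close> 70)
  join :: "'a \<Rightarrow> 'a \<Rightarrow> 'a" (infixl \<open>\<squnion>\<index>\<close> 65)
  imp :: "'a \<Rightarrow> 'a \<Rightarrow> 'a" (infixr \<open>\<leadsto>\<index>\<close> 60)
  zero :: 'a (\<open>\<zero>\<index>\<close>)
  one :: 'a (\<open>\<one>\<index>\<close>)

definition leq :: "'a cha_algebra \<Rightarrow> 'a \<Rightarrow> 'a \<Rightarrow> bool" (infix \<open>\<sqsubseteq>\<index>\<close> 50)
  where "x \<sqsubseteq>\<^bsub>A\<^esub> y \<longleftrightarrow> x \<sqinter>\<^bsub>A\<^esub> y = x"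

definition neg :: "'a cha_algebra \<Rightarrow> 'a \<Rightarrow> 'a" (\<open>\<sim>\<index> _\<close> [81] 80)
  where "\<sim>\<^bsub>A\<^esub> x = x \<leadsto>\<^bsub>A\<^esub> \<zero>\<^bsub>A\<^esub>"

locale bounded_distributive_lattice =
  fixes A :: "'a cha_algebra" (structure)
  assumes meet_closed: "\<lbrakk>x \<in> carrier A; y \<in> carrier A\<rbrakk> \<Longrightarrow> x \<sqinter> y \<in> carrier A"
    and join_closed: "\<lbrakk>x \<in> carrier A; y \<in> carrier A\<rbrakk> \<Longrightarrow> x \<squnion> y \<in> carrier A"
    and zero_closed: "\<zero> \<in> carrier A"
    and one_closed: "\<one> \<in> carrier A"
    and meet_assoc: "\<lbrakk>x \<in> carrier A; y \<in> carrier A; z \<in> carrier A\<rbrakk> \<Longrightarrow> (x \<sqinter> y) \<sqinter> z = x \<sqinter> (y \<sqinter> z)"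
    and join_assoc: "\<lbrakk>x \<in> carrier A; y \<in> carrier A; z \<in> carrier A\<rbrakk> \<Longrightarrow> (x \<squnion> y) \<squnion> z = x \<squnion> (y \<squnion> z)"
    and meet_comm: "\<lbrakk>x \<in> carrier A; y \<in> carrier A\<rbrakk> \<Longrightarrow> x \<sqinter> y = y \<sqinter> x"
    and join_comm: "\<lbrakk>x \<in> carrier A; y \<in> carrier A\<rbrakk> \<Longrightarrow> x \<squnion> y = y \<squnion> x"
    and meet_absorb: "\<lbrakk>x \<in> carrier A; y \<in> carrier A\<rbrakk> \<Longrightarrow> x \<sqinter> (x \<squnion> y) = x"
    and join_absorb: "\<lbrakk>x \<in> carrier A; y \<in> carrier A\<rbrakk> \<Longrightarrow> x \<squnion> (x \<sqinter> y) = x"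
    and distrib: "\<lbrakk>x \<in> carrier A; y \<in> carrier A; z \<in> carrier A\<rbrakk> \<Longrightarrow> x \<sqinter> (y \<squnion> z) = (x \<sqinter> y) \<squnion> (x \<sqinter> z)"
    and zero_least: "x \<in> carrier A \<Longrightarrow> \<zero> \<sqsubseteq> x"
    and one_greatest: "x \<in> carrier A \<Longrightarrow> x \<sqsubseteq> \<one>"

locale connexive_heyting_algebra = bounded_distributive_lattice +
  assumes imp_closed: "\<lbrakk>x \<in> carrier A; y \<in> carrier A\<rbrakk> \<Longrightarrow> x \<leadsto> y \<in> carrier A"
    and C1: "\<lbrakk>x \<in> carrier A; y \<in> carrier A; z \<in> carrier A\<rbrakk> \<Longrightarrow>
      (x \<leadsto> y) \<leadsto> ((y \<leadsto> z) \<leadsto> (x \<leadsto> z)) = \<one>"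
    and C2: "\<lbrakk>x \<in> carrier A; y \<in> carrier A\<rbrakk> \<Longrightarrow> (x \<leadsto> y) \<leadsto> \<sim> (x \<leadsto> \<sim> y) = \<one>"
    and C3: "\<lbrakk>x \<in> carrier A; y \<in> carrier A\<rbrakk> \<Longrightarrow> x \<sqinter> (x \<leadsto> y) = x \<sqinter> y"
    and C4: "\<lbrakk>x \<in> carrier A; y \<in> carrier A; z \<in> carrier A\<rbrakk> \<Longrightarrow>
      (x \<leadsto> y) \<sqsubseteq> ((z \<sqinter> x) \<leadsto> (z \<sqinter> y))"
    and C5: "\<lbrakk>x \<in> carrier A; y \<in> carrier A; z \<in> carrier A\<rbrakk> \<Longrightarrow>
      (x \<leadsto> y) \<sqsubseteq> ((z \<squnion> x) \<leadsto> (z \<squnion> y))"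

definition CHA :: "'a itself \<Rightarrow> 'a cha_algebra set"
  where "CHA _ = {A. connexive_heyting_algebra A}"

definition congruence :: "'a cha_algebra \<Rightarrow> ('a \<times> 'a) set \<Rightarrow> bool"
  where "congruence A \<theta> \<longleftrightarrow> equiv (carrier A) \<theta> \<and>
    (\<forall>x x' y y'. (x, x') \<in> \<theta> \<longrightarrow> (y, y') \<in> \<theta> \<longrightarrow>
      (x \<sqinter>\<^bsub>A\<^esub> y, x' \<sqinter>\<^bsub>A\<^esub> y') \<in> \<theta> \<and>
      (x \<squnion>\<^bsub>A\<^esub> y, x' \<squnion>\<^bsub>A\<^esub> y') \<in> \<theta> \<and>
      (x \<leadsto>\<^bsub>A\<^esub> y, x' \<leadsto>\<^bsub>A\<^esub> y') \<in> \<theta>)"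

definition principal_congruence :: "'a cha_algebra \<Rightarrow> 'a \<Rightarrow> 'a \<Rightarrow> ('a \<times> 'a) set"
  where "principal_congruence A a b = \<Inter>{\<theta>. congruence A \<theta> \<and> (a, b) \<in> \<theta>}"

datatype 'v cha_term =
    Var 'v
  | Zero
  | One
  | Meet "'v cha_term" "'v cha_term"
  | Join "'v cha_term" "'v cha_term"
  | Imp "'v cha_term" "'v cha_term"

primrec eval :: "'a cha_algebra \<Rightarrow> ('v \<Rightarrow> 'a) \<Rightarrow> 'v cha_term \<Rightarrow> 'a"
  where
    "eval A \<rho> (Var v) = \<rho> v"
  | "eval A \<rho> Zero = \<zero>\<^bsub>A\<^esub>"
  | "eval A \<rho> One = \<one>\<^bsub>A\<^esub>"
  | "eval A \<rho> (Meet s t) = eval A \<rho> s \<sqinter>\<^bsub>A\<^esub> eval A \<rho> t"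
  | "eval A \<rho> (Join s t) = eval A \<rho> s \<squnion>\<^bsub>A\<^esub> eval A \<rho> t"
  | "eval A \<rho> (Imp s t) = eval A \<rho> s \<leadsto>\<^bsub>A\<^esub> eval A \<rho> t"

datatype qvar = Vx | Vy | Vz | Vw

definition term_op :: "'a cha_algebra \<Rightarrow> qvar cha_term \<Rightarrow> 'a \<Rightarrow> 'a \<Rightarrow> 'a \<Rightarrow> 'a \<Rightarrow> 'a"
  where "term_op A \<phi> a b c d =
    eval A (\<lambda>v. case v of Vx \<Rightarrow> a | Vy \<Rightarrow> b | Vz \<Rightarrow> c | Vw \<Rightarrow> d) \<phi>"

text \<open>
  A class of algebras can only be given relative to a universe type \<^typ>\<open>'a\<close>, so the assertion
  that some term is quaternary deductive for \<^term>\<open>CHA TYPE('a)\<close> would by itself allow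
  the term to depend on \<^typ>\<open>'a\<close>. That a single term serves for all connexive Heyting algebras is
  expressed by adding that every term which is quaternary deductive for the algebras over
  \<^typ>\<open>nat\<close> (up to isomorphism, the countable ones) is so for those over \<^typ>\<open>'a\<close>; together
  with existence at \<^typ>\<open>nat\<close> this gives one term for all universe types.
\<close>

definition quaternary_deductive_term :: "'a cha_algebra set \<Rightarrow> qvar cha_term \<Rightarrow> bool"
  where "quaternary_deductive_term K \<phi> \<longleftrightarrow>
    (\<forall>A\<in>K. \<forall>a\<in>carrier A. \<forall>b\<in>carrier A. \<forall>c\<in>carrier A. \<forall>d\<in>carrier A.
      (a = b \<longrightarrow> term_op A \<phi> a b c d = c) \<and>
      ((c, d) \<in> principal_congruence A a b \<longrightarrow> term_op A \<phi> a b c d = d))"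

end

theory Submission
  imports Defs "HOL-Library.Countable_Set"
begin

text \<open>
  The term operation \<open>x \<Rightarrow> y := x \<leadsto> (x \<sqinter> y)\<close> is the relative pseudocomplement of the underlying
  lattice. For every element \<open>e\<close>, the relation \<open>e \<sqinter> x = e \<sqinter> y\<close> is a congruence: it is compatible
  with \<open>\<leadsto>\<close> because \<open>e\<close> lies below both \<open>x \<leadsto> (e \<sqinter> x)\<close> and \<open>(e \<sqinter> x) \<leadsto> x\<close>. Taking
  \<open>e = (a \<Rightarrow> b) \<sqinter> (b \<Rightarrow> a)\<close>, membership of \<open>(c, d)\<close> in the congruence generated by \<open>(a, b)\<close> forces
  \<open>e \<sqinter> c = e \<sqinter> d\<close>, and \<open>((e \<Rightarrow> g) \<Rightarrow> d) \<sqinter> (e \<Rightarrow> c)\<close> with \<open>g = (c \<Rightarrow> d) \<sqinter> (d \<Rightarrow> c)\<close> is a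
  deductive term.

  Given one deductive term \<open>\<psi>\<close>, the pair \<open>(c, d)\<close> lies in the congruence generated by \<open>(a, b)\<close> iff
  \<open>\<psi>(a, b, c, d) = d\<close>. This condition is inherited by the countable subalgebra generated by
  \<open>a, b, c, d\<close>, so whether a term is deductive is decided by countable algebras.
\<close>

section \<open>Order and meet in bounded distributive lattices\<close>

context bounded_distributive_lattice
begin

lemma meet_idem: "x \<in> carrier A \<Longrightarrow> x \<sqinter> x = x"
  by (metis join_absorb meet_absorb meet_closed)

lemma meet_one: "x \<in> carrier A \<Longrightarrow> x \<sqinter> \<one> = x"
  using one_greatest by (simp add: leq_def)

lemma one_meet: "x \<in> carrier A \<Longrightarrow> \<one> \<sqinter> x = x"
  by (metis meet_comm meet_one one_closed)

lemma meet_left_comm: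
  "\<lbrakk>x \<in> carrier A; y \<in> carrier A; z \<in> carrier A\<rbrakk> \<Longrightarrow> x \<sqinter> (y \<sqinter> z) = y \<sqinter> (x \<sqinter> z)"
  by (metis meet_assoc meet_comm)

lemma meet_left_idem:
  "\<lbrakk>x \<in> carrier A; y \<in> carrier A\<rbrakk> \<Longrightarrow> x \<sqinter> (x \<sqinter> y) = x \<sqinter> y"
  by (metis meet_assoc meet_idem)

lemmas meet_ac = meet_assoc meet_comm meet_left_comm meet_idem meet_left_idem

lemma leq_refl: "x \<in> carrier A \<Longrightarrow> x \<sqsubseteq> x"
  by (simp add: leq_def meet_idem)

lemma leq_antisym:
  "\<lbrakk>x \<sqsubseteq> y; y \<sqsubseteq> x; x \<in> carrier A; y \<in> carrier A\<rbrakk> \<Longrightarrow> x = y"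
  by (metis leq_def meet_comm)

lemma leq_trans:
  "\<lbrakk>x \<sqsubseteq> y; y \<sqsubseteq> z; x \<in> carrier A; y \<in> carrier A; z \<in> carrier A\<rbrakk> \<Longrightarrow> x \<sqsubseteq> z"
  by (metis leq_def meet_assoc)

lemma meet_lower1: "\<lbrakk>x \<in> carrier A; y \<in> carrier A\<rbrakk> \<Longrightarrow> x \<sqinter> y \<sqsubseteq> x"
  by (simp add: leq_def meet_ac meet_closed)

lemma meet_lower2: "\<lbrakk>x \<in> carrier A; y \<in> carrier A\<rbrakk> \<Longrightarrow> x \<sqinter> y \<sqsubseteq> y"
  by (simp add: leq_def meet_ac meet_closed)

lemma meet_greatest:
  "\<lbrakk>z \<sqsubseteq> x; z \<sqsubseteq> y; x \<in> carrier A; y \<in> carrier A; z \<in> carrier A\<rbrakk> \<Longrightarrow> z \<sqsubseteq> x \<sqinter> y"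
  by (metis leq_def meet_assoc)

end

section \<open>The Heyting operations inside a connexive Heyting algebra\<close>

definition heyting_imp :: "'a cha_algebra \<Rightarrow> 'a \<Rightarrow> 'a \<Rightarrow> 'a"
  where "heyting_imp A x y = x \<leadsto>\<^bsub>A\<^esub> (x \<sqinter>\<^bsub>A\<^esub> y)"

definition heyting_iff :: "'a cha_algebra \<Rightarrow> 'a \<Rightarrow> 'a \<Rightarrow> 'a"
  where "heyting_iff A x y = heyting_imp A x y \<sqinter>\<^bsub>A\<^esub> heyting_imp A y x"

definition deductive_op :: "'a cha_algebra \<Rightarrow> 'a \<Rightarrow> 'a \<Rightarrow> 'a \<Rightarrow> 'a \<Rightarrow> 'a"
  where "deductive_op A a b c d =
    heyting_imp A (heyting_imp A (heyting_iff A a b) (heyting_iff A c d)) d \<sqinter>\<^bsub>A\<^esub>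
    heyting_imp A (heyting_iff A a b) c"

context connexive_heyting_algebra
begin

lemma heyting_imp_closed:
  "\<lbrakk>x \<in> carrier A; y \<in> carrier A\<rbrakk> \<Longrightarrow> heyting_imp A x y \<in> carrier A"
  by (simp add: heyting_imp_def imp_closed meet_closed)

lemma heyting_iff_closed:
  "\<lbrakk>x \<in> carrier A; y \<in> carrier A\<rbrakk> \<Longrightarrow> heyting_iff A x y \<in> carrier A"
  by (simp add: heyting_iff_def heyting_imp_closed meet_closed)

lemma one_imp: "x \<in> carrier A \<Longrightarrow> \<one> \<leadsto> x = x"
  by (metis C3 imp_closed one_closed one_meet)

text \<open>With \<open>p\<close>, \<open>q\<close>, \<open>r\<close> as abbreviated below, C1
  together with C3 puts \<open>p\<close> below \<open>q \<leadsto> r\<close>; C3 at \<open>q\<close>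
  then turns \<open>q \<sqinter> (q \<leadsto> r)\<close> into
  \<open>q \<sqinter> r\<close>.\<close>

lemma imp_trans:
  assumes "x \<in> carrier A" "y \<in> carrier A" "z \<in> carrier A"
  shows "(x \<leadsto> y) \<sqinter> (y \<leadsto> z) \<sqsubseteq> x \<leadsto> z"
proof -
  let ?p = "x \<leadsto> y" and ?q = "y \<leadsto> z" and ?r = "x \<leadsto> z"
  have closed: "?p \<in> carrier A" "?q \<in> carrier A" "?r \<in> carrier A" "?q \<leadsto> ?r \<in> carrier A"
    using assms by (simp_all add: imp_closed)
  have "?p \<sqinter> (?q \<leadsto> ?r) = ?p"
    using C3[of ?p "?q \<leadsto> ?r"] C1[OF assms] closed by (simp add: meet_one)
  then have "?p \<sqinter> ?q = ?p \<sqinter> (?q \<sqinter> (?q \<leadsto> ?r))"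
    by (metis closed meet_assoc meet_comm)
  also have "\<dots> = (?p \<sqinter> ?q) \<sqinter> ?r"
    using closed by (simp add: C3 meet_assoc)
  finally show ?thesis by (simp add: leq_def)
qed

text \<open>This is C4 for \<open>\<one> \<leadsto> e\<close>, which equals
  \<open>e\<close>.\<close>

lemma leq_imp_meet:
  assumes "e \<in> carrier A" "x \<in> carrier A"
  shows "e \<sqsubseteq> x \<leadsto> (e \<sqinter> x)"
  using C4[of \<one> e x] assms by (simp add: one_imp one_closed meet_one meet_comm)

text \<open>Here C4 is applied to \<open>e \<leadsto> \<one>\<close>, which lies above
  \<open>e\<close> by C3.\<close>

lemma leq_meet_imp:
  assumes "e \<in> carrier A" "x \<in> carrier A"
  shows "e \<sqsubseteq> (e \<sqinter> x) \<leadsto> x"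
proof -
  have "e \<sqsubseteq> e \<leadsto> \<one>"
    using C3[of e \<one>] assms by (simp add: leq_def one_closed meet_one)
  moreover have "e \<leadsto> \<one> \<sqsubseteq> (e \<sqinter> x) \<leadsto> x"
    using C4[of e \<one> x] assms by (simp add: one_closed meet_one meet_comm)
  ultimately show ?thesis
    using assms by (meson imp_closed leq_trans meet_closed one_closed)
qed

lemma leq_imp_trans:
  assumes "e \<sqsubseteq> x \<leadsto> y" "e \<sqsubseteq> y \<leadsto> z"
    and "e \<in> carrier A" "x \<in> carrier A" "y \<in> carrier A" "z \<in> carrier A"
  shows "e \<sqsubseteq> x \<leadsto> z"
  using assms imp_trans[of x y z] by (meson imp_closed leq_trans meet_closed meet_greatest)

text \<open>From left to right, C3 evaluates
  \<open>x \<sqinter> (x \<leadsto> (x \<sqinter> y))\<close>. From right to left, \<open>z\<close>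
  lies below two implications that compose at \<open>z \<sqinter> (x \<sqinter> y)\<close>.\<close>

lemma heyting_imp_residuation:
  assumes "x \<in> carrier A" "y \<in> carrier A" "z \<in> carrier A"
  shows "z \<sqsubseteq> heyting_imp A x y \<longleftrightarrow> z \<sqinter> x \<sqsubseteq> y"
proof
  assume "z \<sqsubseteq> heyting_imp A x y"
  then have "z \<sqinter> (x \<leadsto> (x \<sqinter> y)) = z" by (simp add: leq_def heyting_imp_def)
  then have "z \<sqinter> x = z \<sqinter> (x \<sqinter> (x \<leadsto> (x \<sqinter> y)))"
    using assms by (metis imp_closed meet_assoc meet_closed meet_comm)
  also have "\<dots> = z \<sqinter> (x \<sqinter> y)"
    using assms by (simp add: C3 meet_ac meet_closed)
  finally show "z \<sqinter> x \<sqsubseteq> y"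
    using assms by (simp add: leq_def meet_assoc meet_idem meet_closed)
next
  assume "z \<sqinter> x \<sqsubseteq> y"
  then have "z \<sqinter> x = z \<sqinter> (x \<sqinter> y)"
    using assms by (simp add: leq_def meet_assoc)
  then have "z \<sqsubseteq> x \<leadsto> (z \<sqinter> (x \<sqinter> y))"
    using leq_imp_meet[of z x] assms by simp
  moreover have "z \<sqsubseteq> (z \<sqinter> (x \<sqinter> y)) \<leadsto> (x \<sqinter> y)"
    using leq_meet_imp[of z "x \<sqinter> y"] assms by (simp add: meet_closed)
  ultimately show "z \<sqsubseteq> heyting_imp A x y"
    unfolding heyting_imp_def using assms by (meson leq_imp_trans meet_closed)
qed

lemma heyting_imp_eq_one_iff:
  assumes "x \<in> carrier A" "y \<in> carrier A"
  shows "heyting_imp A x y = \<one> \<longleftrightarrow> x \<sqsubseteq> y"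
proof -
  have "heyting_imp A x y = \<one> \<longleftrightarrow> \<one> \<sqsubseteq> heyting_imp A x y"
    using assms by (metis heyting_imp_closed leq_antisym one_closed one_greatest)
  then show ?thesis
    using assms by (simp add: heyting_imp_residuation one_closed one_meet)
qed

lemma one_heyting_imp: "x \<in> carrier A \<Longrightarrow> heyting_imp A \<one> x = x"
  by (simp add: heyting_imp_def one_meet one_imp)

lemma heyting_iff_refl: "x \<in> carrier A \<Longrightarrow> heyting_iff A x x = \<one>"
  using heyting_imp_eq_one_iff[of x x]
  by (simp add: heyting_iff_def leq_refl one_closed meet_one)

text \<open>Hence \<open>heyting_iff A x y\<close> is the largest element whose meets with
  \<open>x\<close> and \<open>y\<close> agree, which is why it serves as the parameter of the
  congruences below.\<close>

lemma leq_heyting_iff: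
  assumes "x \<in> carrier A" "y \<in> carrier A" "e \<in> carrier A"
  shows "e \<sqsubseteq> heyting_iff A x y \<longleftrightarrow> e \<sqinter> x = e \<sqinter> y"
proof -
  have "e \<sqsubseteq> heyting_iff A x y \<longleftrightarrow> e \<sqsubseteq> heyting_imp A x y \<and> e \<sqsubseteq> heyting_imp A y x"
    unfolding heyting_iff_def
    using assms by (meson heyting_imp_closed leq_trans meet_closed meet_greatest meet_lower1
        meet_lower2)
  also have "\<dots> \<longleftrightarrow> e \<sqinter> x \<sqsubseteq> y \<and> e \<sqinter> y \<sqsubseteq> x"
    using assms by (simp add: heyting_imp_residuation)
  also have "\<dots> \<longleftrightarrow> e \<sqinter> x = e \<sqinter> y"
  proof
    assume "e \<sqinter> x \<sqsubseteq> y \<and> e \<sqinter> y \<sqsubseteq> x"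
    then have "e \<sqinter> x \<sqsubseteq> e \<sqinter> y" "e \<sqinter> y \<sqsubseteq> e \<sqinter> x"
      using assms by (simp_all add: meet_greatest meet_lower1 meet_closed)
    then show "e \<sqinter> x = e \<sqinter> y"
      using assms by (simp add: leq_antisym meet_closed)
  next
    assume "e \<sqinter> x = e \<sqinter> y"
    then show "e \<sqinter> x \<sqsubseteq> y \<and> e \<sqinter> y \<sqsubseteq> x"
      using assms meet_lower2[of e x] meet_lower2[of e y] by simp
  qed
  finally show ?thesis .
qed

section \<open>Congruences given by meeting with a fixed element\<close>

lemma meet_imp_relativize:
  assumes "e \<in> carrier A" "x \<in> carrier A" "y \<in> carrier A"
  shows "e \<sqinter> (x \<leadsto> y) = e \<sqinter> ((e \<sqinter> x) \<leadsto> (e \<sqinter> y))"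
proof (rule leq_antisym)
  let ?l = "x \<leadsto> y" and ?r = "(e \<sqinter> x) \<leadsto> (e \<sqinter> y)"
  have closed: "e \<sqinter> x \<in> carrier A" "e \<sqinter> y \<in> carrier A" "?l \<in> carrier A" "?r \<in> carrier A"
    "e \<sqinter> ?l \<in> carrier A" "e \<sqinter> ?r \<in> carrier A"
    using assms by (simp_all add: imp_closed meet_closed)
  \<comment> \<open>This direction is C4; the converse composes \<open>x\<close> to
    \<open>e \<sqinter> x\<close> to \<open>e \<sqinter> y\<close> to \<open>y\<close>, the outer
    two implications lying above \<open>e\<close>.\<close>
  show "e \<sqinter> ?l \<sqsubseteq> e \<sqinter> ?r"
    using C4[of x y e] assms closed
    by (meson leq_trans meet_greatest meet_lower1 meet_lower2)
  have below_e: "e \<sqinter> ?r \<sqsubseteq> e" and below_r: "e \<sqinter> ?r \<sqsubseteq> ?r"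
    using assms closed by (simp_all add: meet_lower1 meet_lower2)
  have "e \<sqinter> ?r \<sqsubseteq> x \<leadsto> (e \<sqinter> x)" "e \<sqinter> ?r \<sqsubseteq> (e \<sqinter> y) \<leadsto> y"
    using assms closed below_e leq_imp_meet[of e x] leq_meet_imp[of e y]
    by (meson imp_closed leq_trans)+
  with below_r have "e \<sqinter> ?r \<sqsubseteq> x \<leadsto> y"
    using assms closed by (meson leq_imp_trans)
  with below_e show "e \<sqinter> ?r \<sqsubseteq> e \<sqinter> ?l"
    using assms closed by (meson meet_greatest)
qed (use assms in \<open>simp_all add: imp_closed meet_closed\<close>)

text \<open>Joins are handled by distributivity. For \<open>\<leadsto>\<close>, relativization shows
  that \<open>e \<sqinter> (x \<leadsto> y)\<close> depends only on \<open>e \<sqinter> x\<close>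
  and \<open>e \<sqinter> y\<close>.\<close>

lemma congruence_meet_eq:
  assumes e: "e \<in> carrier A"
  shows "congruence A {(x, y). x \<in> carrier A \<and> y \<in> carrier A \<and> e \<sqinter> x = e \<sqinter> y}"
    (is "congruence A ?\<theta>")
  unfolding congruence_def
proof (intro conjI allI impI)
  show "equiv (carrier A) ?\<theta>"
    by (auto simp: equiv_def refl_on_def sym_def trans_def)
next
  fix x x' y y'
  assume "(x, x') \<in> ?\<theta>" "(y, y') \<in> ?\<theta>"
  then have closed: "x \<in> carrier A" "x' \<in> carrier A" "y \<in> carrier A" "y' \<in> carrier A"
    and eq: "e \<sqinter> x = e \<sqinter> x'" "e \<sqinter> y = e \<sqinter> y'"
    by auto
  have "e \<sqinter> (x \<sqinter> y) = e \<sqinter> (x' \<sqinter> y')"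
    using closed e eq by (metis meet_assoc meet_left_comm)
  then show "(x \<sqinter> y, x' \<sqinter> y') \<in> ?\<theta>"
    using closed by (simp add: meet_closed)
  show "(x \<squnion> y, x' \<squnion> y') \<in> ?\<theta>"
    using closed e eq by (simp add: join_closed distrib)
  have "e \<sqinter> (x \<leadsto> y) = e \<sqinter> (x' \<leadsto> y')"
    using meet_imp_relativize[of e x y] meet_imp_relativize[of e x' y'] closed e eq by simp
  then show "(x \<leadsto> y, x' \<leadsto> y') \<in> ?\<theta>"
    using closed by (simp add: imp_closed)
qed

lemma principal_congruence_meet_eq:
  assumes "a \<in> carrier A" "b \<in> carrier A" and "(c, d) \<in> principal_congruence A a b"
  shows "heyting_iff A a b \<sqinter> c = heyting_iff A a b \<sqinter> d"
proof -
  let ?e = "heyting_iff A a b"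
  have e: "?e \<in> carrier A"
    using assms by (simp add: heyting_iff_closed)
  \<comment> \<open>Reflexivity of the order at \<open>?e\<close>; so the congruence of
    \<open>?e\<close> contains \<open>(a, b)\<close> and is one of those being intersected.\<close>
  have "?e \<sqinter> a = ?e \<sqinter> b"
    using leq_heyting_iff[of a b ?e] assms e by (simp add: leq_refl)
  then have "(c, d) \<in> {(x, y). x \<in> carrier A \<and> y \<in> carrier A \<and> ?e \<sqinter> x = ?e \<sqinter> y}"
    using assms congruence_meet_eq[OF e] unfolding principal_congruence_def by blast
  then show ?thesis by simp
qed

text \<open>With equal first arguments the parameter is \<open>\<one>\<close>, so the operation
  reduces to the meet of \<open>heyting_imp A ?g d\<close> and \<open>c\<close>; the first factor
  lies above \<open>c\<close> by residuation.\<close>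

lemma deductive_op_same:
  assumes "a \<in> carrier A" "c \<in> carrier A" "d \<in> carrier A"
  shows "deductive_op A a a c d = c"
proof -
  let ?g = "heyting_iff A c d"
  have g: "?g \<in> carrier A"
    using assms by (simp add: heyting_iff_closed)
  have "?g \<sqinter> c = ?g \<sqinter> d"
    using leq_heyting_iff[of c d ?g] assms g by (simp add: leq_refl)
  then have "c \<sqinter> ?g \<sqsubseteq> d"
    using assms g by (metis meet_comm meet_lower2)
  then have "c \<sqsubseteq> heyting_imp A ?g d"
    using assms g by (simp add: heyting_imp_residuation)
  then have "heyting_imp A ?g d \<sqinter> c = c"
    using assms g by (metis heyting_imp_closed leq_def meet_comm)
  then show ?thesis
    using assms g by (simp add: deductive_op_def heyting_iff_refl one_heyting_imp)
qed

text \<open>Now \<open>?e \<sqsubseteq> ?g\<close>, so the first factor collapses to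
  \<open>d\<close>, and the second lies above \<open>d\<close> because
  \<open>d \<sqinter> ?e \<sqsubseteq> c\<close>.\<close>

lemma deductive_op_principal_congruence:
  assumes "a \<in> carrier A" "b \<in> carrier A" "c \<in> carrier A" "d \<in> carrier A"
    and cong: "(c, d) \<in> principal_congruence A a b"
  shows "deductive_op A a b c d = d"
proof -
  let ?e = "heyting_iff A a b" and ?g = "heyting_iff A c d"
  have closed: "?e \<in> carrier A" "?g \<in> carrier A"
    using assms by (simp_all add: heyting_iff_closed)
  have eq: "?e \<sqinter> c = ?e \<sqinter> d"
    using assms principal_congruence_meet_eq by blast
  then have "?e \<sqsubseteq> ?g"
    using assms closed by (simp add: leq_heyting_iff)
  then have "heyting_imp A ?e ?g = \<one>"
    using closed by (simp add: heyting_imp_eq_one_iff)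
  moreover have "d \<sqinter> ?e \<sqsubseteq> c"
    using assms closed eq by (metis meet_comm meet_lower2)
  then have "d \<sqinter> heyting_imp A ?e c = d"
    using assms closed by (simp add: heyting_imp_residuation flip: leq_def)
  ultimately show ?thesis
    using assms by (simp add: deductive_op_def one_heyting_imp)
qed

end

section \<open>The deductive term as a syntactic object\<close>

definition heyting_imp_term :: "'v cha_term \<Rightarrow> 'v cha_term \<Rightarrow> 'v cha_term"
  where "heyting_imp_term s t = Imp s (Meet s t)"

definition heyting_iff_term :: "'v cha_term \<Rightarrow> 'v cha_term \<Rightarrow> 'v cha_term"
  where "heyting_iff_term s t = Meet (heyting_imp_term s t) (heyting_imp_term t s)"

definition deductive_term :: "qvar cha_term"
  where "deductive_term = Meet
    (heyting_imp_term
      (heyting_imp_term (heyting_iff_term (Var Vx) (Var Vy)) (heyting_iff_term (Var Vz) (Var Vw)))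
      (Var Vw))
    (heyting_imp_term (heyting_iff_term (Var Vx) (Var Vy)) (Var Vz))"

lemma term_op_deductive_term: "term_op A deductive_term a b c d = deductive_op A a b c d"
  by (simp add: term_op_def deductive_term_def deductive_op_def heyting_iff_term_def
      heyting_iff_def heyting_imp_term_def heyting_imp_def)

lemma quaternary_deductive_term_deductive_term:
  "quaternary_deductive_term (CHA TYPE('a)) deductive_term"
  by (simp add: quaternary_deductive_term_def CHA_def term_op_deductive_term
      connexive_heyting_algebra.deductive_op_same
      connexive_heyting_algebra.deductive_op_principal_congruence)

section \<open>Principal congruences defined by an equation\<close>

context connexive_heyting_algebra
begin

lemma eval_closed: "range \<rho> \<subseteq> carrier A \<Longrightarrow> eval A \<rho> t \<in> carrier A"
  by (induction t) (auto simp: zero_closed one_closed meet_closed join_closed imp_closed)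

lemma eval_congruence:
  assumes \<theta>: "congruence A \<theta>" and vars: "\<And>v. (\<rho> v, \<rho>' v) \<in> \<theta>"
  shows "(eval A \<rho> t, eval A \<rho>' t) \<in> \<theta>"
proof -
  have "refl_on (carrier A) \<theta>"
    using \<theta> by (simp add: congruence_def equiv_def)
  then have "(\<zero>, \<zero>) \<in> \<theta>" "(\<one>, \<one>) \<in> \<theta>"
    by (simp_all add: refl_onD zero_closed one_closed)
  then show ?thesis
    using \<theta> vars by (induction t) (auto simp: congruence_def)
qed

text \<open>Replaces a quantifier over congruences by one equation, which injective homomorphisms
  preserve and reflect. For the converse, any congruence containing \<open>(a, b)\<close> relates
  \<open>\<psi>(a, a, c, d)\<close>, which is \<open>c\<close>, to
  \<open>\<psi>(a, b, c, d)\<close>, which is \<open>d\<close>.\<close>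

lemma principal_congruence_iff_term_op:
  assumes \<psi>: "quaternary_deductive_term (CHA TYPE('a)) \<psi>"
    and closed: "a \<in> carrier A" "b \<in> carrier A" "c \<in> carrier A" "d \<in> carrier A"
  shows "(c, d) \<in> principal_congruence A a b \<longleftrightarrow> term_op A \<psi> a b c d = d"
proof
  have A: "A \<in> CHA TYPE('a)"
    by (simp add: CHA_def connexive_heyting_algebra_axioms)
  show "term_op A \<psi> a b c d = d" if "(c, d) \<in> principal_congruence A a b"
    using that \<psi> A closed by (simp add: quaternary_deductive_term_def)
  assume eq: "term_op A \<psi> a b c d = d"
  have "(c, d) \<in> \<theta>" if \<theta>: "congruence A \<theta>" and ab: "(a, b) \<in> \<theta>" for \<theta>
  proof -
    have "refl_on (carrier A) \<theta>"
      using \<theta> by (simp add: congruence_def equiv_def)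
    then have "(term_op A \<psi> a a c d, term_op A \<psi> a b c d) \<in> \<theta>"
      unfolding term_op_def using closed ab
      by (intro eval_congruence[OF \<theta>]) (auto split: qvar.split dest: refl_onD)
    moreover have "term_op A \<psi> a a c d = c"
      using \<psi> A closed by (simp add: quaternary_deductive_term_def)
    ultimately show ?thesis using eq by simp
  qed
  then show "(c, d) \<in> principal_congruence A a b"
    by (auto simp: principal_congruence_def)
qed

end

section \<open>Injective homomorphisms into a connexive Heyting algebra\<close>

locale cha_embedding = connexive_heyting_algebra A for A :: "'a cha_algebra" (structure) +
  fixes N :: "'b cha_algebra" and h :: "'b \<Rightarrow> 'a"
  assumes h_inj: "inj_on h (carrier N)"
    and h_closed: "x \<in> carrier N \<Longrightarrow> h x \<in> carrier A"
    and N_closed: "\<lbrakk>x \<in> carrier N; y \<in> carrier N\<rbrakk> \<Longrightarrow> x \<sqinter>\<^bsub>N\<^esub> y \<in> carrier N"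
      "\<lbrakk>x \<in> carrier N; y \<in> carrier N\<rbrakk> \<Longrightarrow> x \<squnion>\<^bsub>N\<^esub> y \<in> carrier N"
      "\<lbrakk>x \<in> carrier N; y \<in> carrier N\<rbrakk> \<Longrightarrow> x \<leadsto>\<^bsub>N\<^esub> y \<in> carrier N"
      "\<zero>\<^bsub>N\<^esub> \<in> carrier N" "\<one>\<^bsub>N\<^esub> \<in> carrier N"
    and h_hom: "\<lbrakk>x \<in> carrier N; y \<in> carrier N\<rbrakk> \<Longrightarrow> h (x \<sqinter>\<^bsub>N\<^esub> y) = h x \<sqinter> h y"
      "\<lbrakk>x \<in> carrier N; y \<in> carrier N\<rbrakk> \<Longrightarrow> h (x \<squnion>\<^bsub>N\<^esub> y) = h x \<squnion> h y"
      "\<lbrakk>x \<in> carrier N; y \<in> carrier N\<rbrakk> \<Longrightarrow> h (x \<leadsto>\<^bsub>N\<^esub> y) = h x \<leadsto> h y"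
      "h \<zero>\<^bsub>N\<^esub> = \<zero>" "h \<one>\<^bsub>N\<^esub> = \<one>"
begin

lemma N_eqI: "\<lbrakk>h x = h y; x \<in> carrier N; y \<in> carrier N\<rbrakk> \<Longrightarrow> x = y"
  using h_inj by (simp add: inj_on_def)

text \<open>All axioms are identities once \<open>\<sqsubseteq>\<close> and negation are unfolded,
  so they are reflected by the injective \<open>h\<close>.\<close>

lemma N_connexive_heyting_algebra: "connexive_heyting_algebra N"
proof unfold_locales
  fix x y z
  assume c: "x \<in> carrier N" "y \<in> carrier N" "z \<in> carrier N"
  note simps = c h_closed N_closed h_hom
  show "x \<sqinter>\<^bsub>N\<^esub> y \<sqinter>\<^bsub>N\<^esub> z = x \<sqinter>\<^bsub>N\<^esub> (y \<sqinter>\<^bsub>N\<^esub> z)"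
    by (rule N_eqI) (simp_all add: simps meet_assoc)
  show "x \<squnion>\<^bsub>N\<^esub> y \<squnion>\<^bsub>N\<^esub> z = x \<squnion>\<^bsub>N\<^esub> (y \<squnion>\<^bsub>N\<^esub> z)"
    by (rule N_eqI) (simp_all add: simps join_assoc)
  show "x \<sqinter>\<^bsub>N\<^esub> (y \<squnion>\<^bsub>N\<^esub> z) = x \<sqinter>\<^bsub>N\<^esub> y \<squnion>\<^bsub>N\<^esub> x \<sqinter>\<^bsub>N\<^esub> z"
    by (rule N_eqI) (simp_all add: simps distrib)
  show "(x \<leadsto>\<^bsub>N\<^esub> y) \<leadsto>\<^bsub>N\<^esub> (y \<leadsto>\<^bsub>N\<^esub> z) \<leadsto>\<^bsub>N\<^esub> x \<leadsto>\<^bsub>N\<^esub> z = \<one>\<^bsub>N\<^esub>"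
    by (rule N_eqI) (simp_all add: simps C1)
  show "(x \<leadsto>\<^bsub>N\<^esub> y) \<sqsubseteq>\<^bsub>N\<^esub> (z \<sqinter>\<^bsub>N\<^esub> x \<leadsto>\<^bsub>N\<^esub> z \<sqinter>\<^bsub>N\<^esub> y)"
    unfolding leq_def by (rule N_eqI) (simp_all add: simps C4[unfolded leq_def])
  show "(x \<leadsto>\<^bsub>N\<^esub> y) \<sqsubseteq>\<^bsub>N\<^esub> (z \<squnion>\<^bsub>N\<^esub> x \<leadsto>\<^bsub>N\<^esub> z \<squnion>\<^bsub>N\<^esub> y)"
    unfolding leq_def by (rule N_eqI) (simp_all add: simps C5[unfolded leq_def])
next
  fix x y
  assume c: "x \<in> carrier N" "y \<in> carrier N"
  note simps = c h_closed N_closed h_hom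
  show "x \<sqinter>\<^bsub>N\<^esub> y = y \<sqinter>\<^bsub>N\<^esub> x"
    by (rule N_eqI) (simp_all add: simps meet_comm)
  show "x \<squnion>\<^bsub>N\<^esub> y = y \<squnion>\<^bsub>N\<^esub> x"
    by (rule N_eqI) (simp_all add: simps join_comm)
  show "x \<sqinter>\<^bsub>N\<^esub> (x \<squnion>\<^bsub>N\<^esub> y) = x"
    by (rule N_eqI) (simp_all add: simps meet_absorb)
  show "x \<squnion>\<^bsub>N\<^esub> x \<sqinter>\<^bsub>N\<^esub> y = x"
    by (rule N_eqI) (simp_all add: simps join_absorb)
  show "(x \<leadsto>\<^bsub>N\<^esub> y) \<leadsto>\<^bsub>N\<^esub> \<sim>\<^bsub>N\<^esub> (x \<leadsto>\<^bsub>N\<^esub> \<sim>\<^bsub>N\<^esub> y) = \<one>\<^bsub>N\<^esub>"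
    unfolding neg_def by (rule N_eqI) (simp_all add: simps C2[unfolded neg_def])
  show "x \<sqinter>\<^bsub>N\<^esub> (x \<leadsto>\<^bsub>N\<^esub> y) = x \<sqinter>\<^bsub>N\<^esub> y"
    by (rule N_eqI) (simp_all add: simps C3)
next
  fix x
  assume c: "x \<in> carrier N"
  note simps = c h_closed N_closed h_hom
  show "\<zero>\<^bsub>N\<^esub> \<sqsubseteq>\<^bsub>N\<^esub> x"
    unfolding leq_def by (rule N_eqI) (simp_all add: simps zero_least[unfolded leq_def])
  show "x \<sqsubseteq>\<^bsub>N\<^esub> \<one>\<^bsub>N\<^esub>"
    unfolding leq_def by (rule N_eqI) (simp_all add: simps one_greatest[unfolded leq_def])
qed (simp_all add: N_closed)

lemma h_eval:
  assumes "range \<rho> \<subseteq> carrier N"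
  shows "h (eval N \<rho> t) = eval A (\<lambda>v. h (\<rho> v)) t"
  by (induction t)
    (simp_all add: h_hom connexive_heyting_algebra.eval_closed[OF N_connexive_heyting_algebra assms])

lemma h_term_op:
  assumes "a \<in> carrier N" "b \<in> carrier N" "c \<in> carrier N" "d \<in> carrier N"
  shows "h (term_op N t a b c d) = term_op A t (h a) (h b) (h c) (h d)"
proof -
  have "(\<lambda>v. h (case v of Vx \<Rightarrow> a | Vy \<Rightarrow> b | Vz \<Rightarrow> c | Vw \<Rightarrow> d)) =
      (\<lambda>v. case v of Vx \<Rightarrow> h a | Vy \<Rightarrow> h b | Vz \<Rightarrow> h c | Vw \<Rightarrow> h d)"
    by (auto split: qvar.split)
  then show ?thesis
    unfolding term_op_def using assms by (subst h_eval) (auto split: qvar.split)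
qed

end

section \<open>Reduction to countable algebras\<close>

instance qvar :: countable
  by countable_datatype

instance cha_term :: (countable) countable
  by countable_datatype

lemma (in connexive_heyting_algebra) countable_subalgebra_embedding:
  fixes \<rho> :: "'v::countable \<Rightarrow> 'a"
  assumes \<rho>: "range \<rho> \<subseteq> carrier A"
  obtains N :: "nat cha_algebra" and h where "cha_embedding A N h" "range \<rho> \<subseteq> h ` carrier N"
proof -
  \<comment> \<open>The subalgebra generated by the values of \<open>\<rho>\<close>, countable
    because there are countably many terms.\<close>
  define B where "B = range (eval A \<rho>)"
  define g where "g = to_nat_on B"
  define h where "h = from_nat_into B"
  have B_closed: "B \<subseteq> carrier A"
    using eval_closed[OF \<rho>] by (auto simp: B_def)
  have hg: "h (g x) = x" if "x \<in> B" for x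
    using that by (simp add: g_def h_def B_def)
  have in_B: "eval A \<rho> t \<in> B" for t
    by (simp add: B_def)
  have ops: "x \<sqinter> y \<in> B" "x \<squnion> y \<in> B" "x \<leadsto> y \<in> B" if xy: "x \<in> B" "y \<in> B" for x y
  proof -
    obtain s t where "x = eval A \<rho> s" "y = eval A \<rho> t"
      using xy by (auto simp: B_def)
    then show "x \<sqinter> y \<in> B" "x \<squnion> y \<in> B" "x \<leadsto> y \<in> B"
      using in_B[of "Meet s t"] in_B[of "Join s t"] in_B[of "Imp s t"] by simp_all
  qed
  have bounds: "\<zero> \<in> B" "\<one> \<in> B"
    using in_B[of Zero] in_B[of One] by simp_all
  define N where "N = \<lparr>carrier = g ` B, meet = \<lambda>x y. g (h x \<sqinter> h y),
    join = \<lambda>x y. g (h x \<squnion> h y), imp = \<lambda>x y. g (h x \<leadsto> h y), zero = g \<zero>, one = g \<one>\<rparr>"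
  have "cha_embedding A N h"
    using B_closed
    by unfold_locales (auto simp: N_def hg ops bounds inj_on_def)
  moreover have "\<rho> v \<in> h ` carrier N" for v
  proof -
    have "\<rho> v \<in> B"
      using in_B[of "Var v"] by simp
    then show ?thesis
      by (force simp: N_def hg image_iff)
  qed
  ultimately show ?thesis using that by blast
qed

text \<open>The hypothesis speaks only of algebras over \<open>nat\<close>, so it is applied to a
  countable copy \<open>N\<close> of a subalgebra containing the four arguments.\<close>

lemma quaternary_deductive_term_transfer:
  assumes \<phi>: "quaternary_deductive_term (CHA TYPE(nat)) \<phi>"
  shows "quaternary_deductive_term (CHA TYPE('a)) \<phi>"
  unfolding quaternary_deductive_term_def
proof (intro ballI)
  fix A :: "'a cha_algebra" and a b c d
  assume A: "A \<in> CHA TYPE('a)"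
    and closed: "a \<in> carrier A" "b \<in> carrier A" "c \<in> carrier A" "d \<in> carrier A"
  interpret A: connexive_heyting_algebra A
    using A by (simp add: CHA_def)
  let ?\<rho> = "\<lambda>v. case v of Vx \<Rightarrow> a | Vy \<Rightarrow> b | Vz \<Rightarrow> c | Vw \<Rightarrow> d"
  have "range ?\<rho> \<subseteq> carrier A"
    using closed by (auto split: qvar.split)
  then obtain N :: "nat cha_algebra" and h
    where emb: "cha_embedding A N h" and \<rho>: "range ?\<rho> \<subseteq> h ` carrier N"
    by (rule A.countable_subalgebra_embedding)
  interpret cha_embedding A N h by (fact emb)
  have "?\<rho> v \<in> h ` carrier N" for v
    using \<rho> by blast
  from this[of Vx] this[of Vy] this[of Vz] this[of Vw]
  obtain a' b' c' d' where N: "a' \<in> carrier N" "b' \<in> carrier N" "c' \<in> carrier N" "d' \<in> carrier N"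
    and h: "a = h a'" "b = h b'" "c = h c'" "d = h d'"
    by auto
  interpret N: connexive_heyting_algebra N
    by (rule N_connexive_heyting_algebra)
  have "N \<in> CHA TYPE(nat)"
    by (simp add: CHA_def N_connexive_heyting_algebra)
  with \<phi> N have \<phi>_same: "a' = b' \<Longrightarrow> term_op N \<phi> a' b' c' d' = c'"
    and \<phi>_cong: "(c', d') \<in> principal_congruence N a' b' \<Longrightarrow> term_op N \<phi> a' b' c' d' = d'"
    by (simp_all add: quaternary_deductive_term_def)
  have transfer: "term_op A t a b c d = h (term_op N t a' b' c' d')" for t
    using h_term_op N h by simp
  \<comment> \<open>Injectivity of \<open>h\<close> turns \<open>a = b\<close> into
    \<open>a' = b'\<close>.\<close>
  have "term_op A \<phi> a b c d = c" if "a = b"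
    using that \<phi>_same transfer N h N_eqI by metis
  moreover have "term_op A \<phi> a b c d = d" if "(c, d) \<in> principal_congruence A a b"
  proof -
    \<comment> \<open>Membership in the principal congruence has to descend from \<open>A\<close> to
      \<open>N\<close>. Since \<open>deductive_term\<close> is deductive over both universe types,
      its equation carries the membership down; only then does \<open>\<phi>\<close> apply in
      \<open>N\<close>.\<close>
    have "term_op A deductive_term a b c d = d"
      using that closed
      by (simp add: A.principal_congruence_iff_term_op[OF quaternary_deductive_term_deductive_term])
    then have "h (term_op N deductive_term a' b' c' d') = h d'"
      using transfer h(4) by metis
    moreover have "term_op N deductive_term a' b' c' d' \<in> carrier N"
      unfolding term_op_def using N by (intro N.eval_closed) (auto split: qvar.split)
    ultimately have "term_op N deductive_term a' b' c' d' = d'"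
      using N N_eqI by blast
    then have "(c', d') \<in> principal_congruence N a' b'"
      using N by (simp add:
          N.principal_congruence_iff_term_op[OF quaternary_deductive_term_deductive_term])
    then show ?thesis
      using \<phi>_cong transfer h by simp
  qed
  ultimately show "(a = b \<longrightarrow> term_op A \<phi> a b c d = c) \<and>
      ((c, d) \<in> principal_congruence A a b \<longrightarrow> term_op A \<phi> a b c d = d)"
    by blast
qed

theorem theorem3p11:
  shows "(\<exists>\<phi>. quaternary_deductive_term (CHA TYPE('a)) \<phi>) \<and>
    (\<forall>\<phi>. quaternary_deductive_term (CHA TYPE(nat)) \<phi> \<longrightarrow>
      quaternary_deductive_term (CHA TYPE('a)) \<phi>)"
  using quaternary_deductive_term_deductive_term quaternary_deductive_term_transfer by blast

end
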